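(* Let $\mathcal{H}$ be a separable complex Hilbert space and let $A_0:\operatorname{dom}(A_0)\subseteq\mathcal{H}\to\mathcal{H}$ be a densely defined, closed and skew-symmetric linear operator. Let $A$ be an $m$-accretive operator on $\mathcal{H}$ with $A_0\subseteq A\subseteq -A_0^{*}$. Let $\beta>\alpha>0$ and let $(C_n)_n$ be a sequence in $\mathcal{L}(\mathcal{H})$ with $$\operatorname{Re}\langle C_n\phi\mid\phi\rangle\ \ge\ \max\Bigl\{\alpha\|\phi\|^2,\ \frac1\beta\|C_n\phi\|^2\Bigr\}\qquad\text{for all }\phi\in\mathcal{H}\text{ and all }n.$$ Then there exist a subsequence $(C_{n_k})_k$ and an operator $C\in\mathcal{L}(\mathcal{H})$ satisfying the same inequalities, i.e. $\operatorname{Re}\langle C\phi\mid\phi\rangle\ge\max\{\alpha\|\phi\|^2,\frac1\beta\|C\phi\|^2\}$ for all $\phi\in\mathcal{H}$, such that $$(C_{n_k}+A)^{-1}\to(C+A)^{-1}$$ in the weak operator topology.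
   Context: $\mathcal{L}(\mathcal{H})$ is the space of bounded linear operators on $\mathcal{H}$; the scalar product $\langle\,\cdot\mid\cdot\,\rangle$ is anti-linear in the second entry. A densely defined operator $A_0$ is skew-symmetric if $A_0\subseteq -A_0^{*}$. A linear operator $A$ on $\mathcal{H}$ is called $m$-accretive if $A$ is densely defined and closed with $\operatorname{Re}\langle A\phi\mid\phi\rangle\ge 0$ for all $\phi\in\operatorname{dom}(A)$ and $\operatorname{Re}\langle A^{*}\psi\mid\psi\rangle\ge 0$ for all $\psi\in\operatorname{dom}(A^{*})$. The operators $C_{n}+A$ and $C+A$ have domain $\operatorname{dom}(A)$, and their inverses are bounded operators defined on all of $\mathcal{H}$. *)

theory Defs
  imports "HOL-Analysis.Analysis"
begin

section \<open>Complex Hilbert spaces\<close>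

(* The inner product is linear in the first and anti-linear in the second entry.
   The last axiom says that the norm of the underlying Banach space is the one induced by
   the inner product; since the norm is definite it also makes the inner product
   positive definite. *)
class complex_hilbert = banach +
  fixes scaleC :: "complex \<Rightarrow> 'a \<Rightarrow> 'a"  (infixr \<open>*\<^sub>C\<close> 75)
    and cinner :: "'a \<Rightarrow> 'a \<Rightarrow> complex"
  assumes scaleC_add_right: "c *\<^sub>C (x + y) = c *\<^sub>C x + c *\<^sub>C y"
    and scaleC_add_left: "(c + d) *\<^sub>C x = c *\<^sub>C x + d *\<^sub>C x"
    and scaleC_scaleC: "c *\<^sub>C (d *\<^sub>C x) = (c * d) *\<^sub>C x"
    and scaleC_of_real: "complex_of_real r *\<^sub>C x = r *\<^sub>R x"
    and cinner_add_left: "cinner (x + y) z = cinner x z + cinner y z"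
    and cinner_scaleC_left: "cinner (c *\<^sub>C x) y = c * cinner x y"
    and cinner_commute: "cinner x y = cnj (cinner y x)"
    and cinner_norm: "cinner x x = complex_of_real ((norm x)\<^sup>2)"

instantiation complex :: complex_hilbert
begin
definition "c *\<^sub>C (x::complex) = c * x"
definition "cinner (x::complex) y = x * cnj y"
instance
proof
  show "cinner (x::complex) x = complex_of_real ((norm x)\<^sup>2)" for x
    by (simp add: cinner_complex_def complex_norm_square del: of_real_power)
qed (simp_all add: scaleC_complex_def cinner_complex_def distrib_left distrib_right
    scaleR_conv_of_real)
end


section \<open>Bounded operators and the weak operator topology\<close>

definition bounded_clinear :: "('a::complex_hilbert \<Rightarrow> 'a) \<Rightarrow> bool" where
  "bounded_clinear T \<longleftrightarrow> bounded_linear T \<and> (\<forall>c x. T (c *\<^sub>C x) = c *\<^sub>C T x)"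

(* The underlying set is the space of bounded operators; the topology is the coarsest one
   making all maps "T to cinner (T x) y" continuous. *)
definition weak_operator_topology :: "('a::complex_hilbert \<Rightarrow> 'a) topology" where
  "weak_operator_topology =
     topology_generated_by
       {{T. bounded_clinear T \<and> cinner (T x) y \<in> U} | x y U. open U}"

lemma topspace_weak_operator_topology:
  "topspace (weak_operator_topology :: ('a::complex_hilbert \<Rightarrow> 'a) topology) = Collect bounded_clinear"
proof -
  have "Collect bounded_clinear \<in>
      {{T::'a \<Rightarrow> 'a. bounded_clinear T \<and> cinner (T x) y \<in> U} | x y U. open U}"
    by (intro CollectI exI[of _ UNIV] exI[of _ "0::'a"]) simp
  then show ?thesis
    unfolding weak_operator_topology_def topology_generated_by_topspace by blast
qed

lemma limitin_weak_operator_topology: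
  "limitin weak_operator_topology T S F \<longleftrightarrow>
     bounded_clinear S \<and> (\<forall>\<^sub>F n in F. bounded_clinear (T n)) \<and>
     (\<forall>x y. ((\<lambda>n. cinner (T n x) y) \<longlongrightarrow> cinner (S x) y) F)"
  (is "?L \<longleftrightarrow> ?R")
proof
  assume L: ?L
  have S: "bounded_clinear S"
    using L by (auto simp: limitin_def topspace_weak_operator_topology)
  have T: "\<forall>\<^sub>F n in F. bounded_clinear (T n)"
    using L openin_topspace[of weak_operator_topology]
    by (auto simp: limitin_def topspace_weak_operator_topology)
  have "((\<lambda>n. cinner (T n x) y) \<longlongrightarrow> cinner (S x) y) F" for x y
  proof (rule topological_tendstoI)
    fix U assume U: "open U" "cinner (S x) y \<in> U"
    have "openin weak_operator_topology {T. bounded_clinear T \<and> cinner (T x) y \<in> U}"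
      unfolding weak_operator_topology_def using U(1)
      by (intro topology_generated_by_Basis) blast
    then have "\<forall>\<^sub>F n in F. T n \<in> {T. bounded_clinear T \<and> cinner (T x) y \<in> U}"
      using L S U(2) unfolding limitin_def by blast
    then show "\<forall>\<^sub>F n in F. cinner (T n x) y \<in> U"
      by (rule eventually_mono) simp
  qed
  with S T show ?R by blast
next
  assume R: ?R
  have "\<forall>\<^sub>F n in F. T n \<in> U" if "openin weak_operator_topology U" "S \<in> U" for U
  proof -
    have "generate_topology_on {{T. bounded_clinear T \<and> cinner (T x) y \<in> U} | x y U. open U} U"
      using that(1) unfolding weak_operator_topology_def
      by (rule openin_topology_generated_by)
    then show ?thesis using that(2)
    proof (induction rule: generate_topology_on.induct)
      case (Basis s)
      then obtain x y V where s: "s = {T. bounded_clinear T \<and> cinner (T x) y \<in> V}" "open V"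
        by blast
      have "\<forall>\<^sub>F n in F. cinner (T n x) y \<in> V"
        using R Basis s by (intro topological_tendstoD[of _ "cinner (S x) y"]) auto
      moreover have "\<forall>\<^sub>F n in F. bounded_clinear (T n)" using R by blast
      ultimately show ?case unfolding s by eventually_elim simp
    next
      case (UN K)
      then obtain k where k: "k \<in> K" "S \<in> k" by blast
      with UN have "\<forall>\<^sub>F n in F. T n \<in> k" by blast
      then show ?case by (rule eventually_mono) (use k in blast)
    qed (auto intro: eventually_conj)
  qed
  with R show ?L by (auto simp: limitin_def topspace_weak_operator_topology)
qed


section \<open>Unbounded operators\<close>

(* An unbounded operator A is identified with its graph: (x, y) is in A iff x is in dom(A)
   and A x = y. So Domain A is dom(A), subset is extension of operators, and converse A is
   the inverse relation. *)
type_synonym 'a op_graph = "('a \<times> 'a) set"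

definition linear_operator :: "'a::complex_hilbert op_graph \<Rightarrow> bool" where
  "linear_operator A \<longleftrightarrow>
     single_valued A \<and> (0, 0) \<in> A \<and>
     (\<forall>x y x' y'. (x, y) \<in> A \<longrightarrow> (x', y') \<in> A \<longrightarrow> (x + x', y + y') \<in> A) \<and>
     (\<forall>c x y. (x, y) \<in> A \<longrightarrow> (c *\<^sub>C x, c *\<^sub>C y) \<in> A)"

definition densely_defined :: "'a::complex_hilbert op_graph \<Rightarrow> bool" where
  "densely_defined A \<longleftrightarrow> closure (Domain A) = UNIV"

definition graph_of :: "('a \<Rightarrow> 'a) \<Rightarrow> 'a op_graph" where
  "graph_of T = {(x, T x) | x. True}"

(* For densely defined A this is single-valued. *)
definition adjoint_op :: "'a::complex_hilbert op_graph \<Rightarrow> 'a op_graph" where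
  "adjoint_op A = {(y, z). \<forall>(x, w) \<in> A. cinner w y = cinner x z}"

definition minus_op :: "'a::complex_hilbert op_graph \<Rightarrow> 'a op_graph" where
  "minus_op A = {(x, - y) | x y. (x, y) \<in> A}"

definition plus_op :: "('a \<Rightarrow> 'a) \<Rightarrow> 'a::complex_hilbert op_graph \<Rightarrow> 'a op_graph" where
  "plus_op T A = {(x, T x + y) | x y. (x, y) \<in> A}"

definition skew_symmetric :: "'a::complex_hilbert op_graph \<Rightarrow> bool" where
  "skew_symmetric A \<longleftrightarrow> A \<subseteq> minus_op (adjoint_op A)"

definition m_accretive :: "'a::complex_hilbert op_graph \<Rightarrow> bool" where
  "m_accretive A \<longleftrightarrow>
     linear_operator A \<and> densely_defined A \<and> closed A \<and>
     (\<forall>(x, y) \<in> A. Re (cinner y x) \<ge> 0) \<and>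
     (\<forall>(x, y) \<in> adjoint_op A. Re (cinner y x) \<ge> 0)"

definition boundedly_invertible :: "'a::complex_hilbert op_graph \<Rightarrow> bool" where
  "boundedly_invertible A \<longleftrightarrow> (\<exists>R. bounded_clinear R \<and> graph_of R = converse A)"

(* Only meaningful if A is boundedly invertible. *)
definition inverse_op :: "'a::complex_hilbert op_graph \<Rightarrow> ('a \<Rightarrow> 'a)" where
  "inverse_op A = (THE R. bounded_clinear R \<and> graph_of R = converse A)"

lemma inverse_op:
  assumes "boundedly_invertible A"
  shows "bounded_clinear (inverse_op A)" "graph_of (inverse_op A) = converse A"
proof -
  have "\<exists>!R. bounded_clinear R \<and> graph_of R = converse A"
  proof (rule ex_ex1I)
    fix R S :: "'a \<Rightarrow> 'a"
    assume "bounded_clinear R \<and> graph_of R = converse A"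
      and "bounded_clinear S \<and> graph_of S = converse A"
    then have "graph_of R = graph_of S" by simp
    then show "R = S" unfolding graph_of_def by (intro ext) blast
  qed (use assms in \<open>auto simp: boundedly_invertible_def\<close>)
  from theI'[OF this] show "bounded_clinear (inverse_op A)"
    "graph_of (inverse_op A) = converse A"
    unfolding inverse_op_def by blast+
qed

end

theory Submission
  imports Defs
begin

text \<open>
  Every coercive perturbation \<open>C\<^sub>n + A\<close> of the m-accretive operator \<open>A\<close> is invertible, and both
  \<open>R\<^sub>n = (C\<^sub>n + A)\<^sup>-\<^sup>1\<close> and \<open>K\<^sub>n = C\<^sub>n R\<^sub>n = 1 - A R\<^sub>n\<close> are bounded uniformly in \<open>n\<close>. In a separable space
  both therefore converge in the weak operator topology along a common subsequence, say to \<open>R\<close>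
  and \<open>K\<close>. The graph of \<open>A\<close> is weakly closed, so \<open>A R = 1 - K\<close>. If \<open>K = D R\<close> for some bounded \<open>D\<close>,
  then \<open>(D + A) R = 1\<close>, that is \<open>R = (D + A)\<^sup>-\<^sup>1\<close>. The task is to find such a \<open>D\<close> and to show that it
  inherits the two inequalities.

  The key is \<open>coercivity_of_weak_limit\<close>. With \<open>u\<^sub>n = R\<^sub>n f\<close> and \<open>q\<^sub>n = K\<^sub>n f\<close> one has
  \<open>Re \<langle>q\<^sub>n, u\<^sub>n\<rangle> = Re \<langle>f, u\<^sub>n\<rangle> - Re \<langle>A u\<^sub>n, u\<^sub>n\<rangle>\<close>. The first term on the right is weakly continuous. The
  form \<open>Re \<langle>A u, u\<rangle>\<close> is nonnegative, hence weakly lower semicontinuous. So \<open>Re \<langle>q\<^sub>n, u\<^sub>n\<rangle>\<close>, although a product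
  of weakly convergent sequences, can only jump upwards in the limit, while the squared norms
  that it dominates can only jump downwards. The two inequalities for \<open>C\<^sub>n\<close> thus become
  \<open>Re \<langle>K f, R f\<rangle> \<ge> \<alpha> \<parallel>R f\<parallel>\<^sup>2\<close> and \<open>Re \<langle>K f, R f\<rangle> \<ge> \<parallel>K f\<parallel>\<^sup>2 / \<beta>\<close>. The second one gives \<open>\<parallel>K f\<parallel> \<le> \<beta> \<parallel>R f\<parallel>\<close>, so that
  \<open>R f \<mapsto> K f\<close> is a well-defined bounded operator on the range of \<open>R\<close>.

  That range is dense: if \<open>f\<close> is orthogonal to it, then \<open>0 = Re \<langle>f, R f\<rangle> = Re \<langle>K f, R f\<rangle> + Re \<langle>A R f, R f\<rangle>\<close>
  is at least \<open>\<alpha> \<parallel>R f\<parallel>\<^sup>2\<close>, so \<open>R f = 0\<close>, then \<open>K f = 0\<close>, and \<open>f = K f + A R f = 0\<close>. The extension \<open>D\<close>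
  by continuity satisfies the inequalities because they are closed conditions.
\<close>


section \<open>Geometry of complex Hilbert spaces\<close>

lemma cinner_add_right: "cinner x (y + z) = cinner x y + cinner x z"
  by (metis cinner_add_left cinner_commute complex_cnj_add)

lemma cinner_scaleC_right: "cinner x (c *\<^sub>C y) = cnj c * cinner x y"
  by (metis cinner_scaleC_left cinner_commute complex_cnj_mult)

lemma cinner_scaleR_left: "cinner (r *\<^sub>R x) y = r *\<^sub>R cinner x y"
  by (metis cinner_scaleC_left scaleC_of_real scaleR_conv_of_real)

lemma cinner_scaleR_right: "cinner x (r *\<^sub>R y) = r *\<^sub>R cinner x y"
  by (metis cinner_scaleC_right scaleC_of_real scaleR_conv_of_real complex_cnj_complex_of_real)

lemma cinner_minus_left: "cinner (- x) y = - cinner x y"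
  using cinner_scaleR_left[of "-1" x y] by simp

lemma cinner_minus_right: "cinner x (- y) = - cinner x y"
  using cinner_scaleR_right[of x "-1" y] by simp

lemma cinner_diff_left: "cinner (x - y) z = cinner x z - cinner y z"
  using cinner_add_left[of x "- y" z] by (simp add: cinner_minus_left)

lemma cinner_diff_right: "cinner x (y - z) = cinner x y - cinner x z"
  using cinner_add_right[of x y "- z"] by (simp add: cinner_minus_right)

lemma cinner_zero_left [simp]: "cinner 0 y = 0"
  using cinner_diff_left[of 0 0 y] by simp

lemma cinner_zero_right [simp]: "cinner x 0 = 0"
  using cinner_diff_right[of x 0 0] by simp

lemmas cinner_simps = cinner_add_left cinner_add_right cinner_diff_left cinner_diff_right
  cinner_minus_left cinner_minus_right cinner_scaleR_left cinner_scaleR_right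

lemma Re_cinner_commute: "Re (cinner x y) = Re (cinner y x)"
  using cinner_commute[of x y] by simp

lemma Re_cinner_self: "Re (cinner x x) = (norm x)\<^sup>2"
  by (simp add: cinner_norm del: of_real_power)

lemma norm_add_squared: "(norm (x + y))\<^sup>2 = (norm x)\<^sup>2 + 2 * Re (cinner x y) + (norm y)\<^sup>2"
  for x y :: "'a::complex_hilbert"
  using Re_cinner_commute[of x y]
  by (simp add: Re_cinner_self[symmetric] cinner_simps)

lemma norm_diff_squared: "(norm (x - y))\<^sup>2 = (norm x)\<^sup>2 - 2 * Re (cinner x y) + (norm y)\<^sup>2"
  for x y :: "'a::complex_hilbert"
  using Re_cinner_commute[of x y]
  by (simp add: Re_cinner_self[symmetric] cinner_simps)

lemma norm_scaleC: "norm (c *\<^sub>C x) = cmod c * norm x" for x :: "'a::complex_hilbert"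
proof -
  have "complex_of_real ((norm (c *\<^sub>C x))\<^sup>2) = complex_of_real ((cmod c * norm x)\<^sup>2)"
    unfolding cinner_norm[symmetric] cinner_scaleC_left cinner_scaleC_right
    by (simp add: cinner_norm power_mult_distrib complex_norm_square mult_ac del: of_real_power)
  then have "(norm (c *\<^sub>C x))\<^sup>2 = (cmod c * norm x)\<^sup>2"
    by (simp only: of_real_eq_iff)
  then show ?thesis by (simp add: power2_eq_iff_nonneg)
qed

lemma cauchy_schwarz: "cmod (cinner x y) \<le> norm x * norm y" for x y :: "'a::complex_hilbert"
proof (cases "y = 0")
  case False
  define N where "N = (norm y)\<^sup>2"
  have N: "N > 0" using False by (simp add: N_def)
  define p where "p = (cinner x y / complex_of_real N) *\<^sub>C y"
  have "cinner x p = cnj (cinner x y) * cinner x y / complex_of_real N"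
    by (simp add: p_def cinner_scaleC_right)
  also have "\<dots> = complex_of_real ((cmod (cinner x y))\<^sup>2 / N)"
    by (simp add: complex_norm_square mult.commute del: of_real_power)
  finally have xp: "Re (cinner x p) = (cmod (cinner x y))\<^sup>2 / N"
    by (simp del: of_real_power of_real_divide)
  have "(norm p)\<^sup>2 = (cmod (cinner x y) / N * norm y)\<^sup>2"
    using N by (simp add: p_def norm_scaleC norm_divide)
  also have "\<dots> = (cmod (cinner x y))\<^sup>2 / N\<^sup>2 * N"
    by (simp add: power_mult_distrib power_divide N_def)
  also have "\<dots> = (cmod (cinner x y))\<^sup>2 / N"
    using N by (simp add: power2_eq_square)
  finally have pp: "(norm p)\<^sup>2 = (cmod (cinner x y))\<^sup>2 / N" .
  have "0 \<le> (norm (x - p))\<^sup>2" by simp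
  also have "\<dots> = (norm x)\<^sup>2 - (cmod (cinner x y))\<^sup>2 / N"
    by (simp add: norm_diff_squared xp pp)
  finally have "(cmod (cinner x y))\<^sup>2 \<le> (norm x * norm y)\<^sup>2"
    using N by (simp add: field_simps N_def)
  then show ?thesis by (rule power2_le_imp_le) simp
qed simp

lemma Re_cinner_le: "\<bar>Re (cinner x y)\<bar> \<le> norm x * norm y" for x y :: "'a::complex_hilbert"
  using abs_Re_le_cmod[of "cinner x y"] cauchy_schwarz[of x y] by linarith

lemma bounded_bilinear_cinner: "bounded_bilinear (cinner :: 'a::complex_hilbert \<Rightarrow> 'a \<Rightarrow> complex)"
proof
  show "\<exists>K. \<forall>x y. cmod (cinner (x::'a) y) \<le> norm x * norm y * K"
    by (rule exI[of _ 1]) (simp add: cauchy_schwarz)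
qed (simp_all add: cinner_simps)

lemma bounded_linear_scaleC: "bounded_linear (\<lambda>x::'a::complex_hilbert. c *\<^sub>C x)"
proof (rule bounded_linear_intro)
  show "c *\<^sub>C (r *\<^sub>R x) = r *\<^sub>R (c *\<^sub>C x)" for r and x :: 'a
    by (simp add: scaleC_of_real[symmetric] scaleC_scaleC mult.commute)
  show "norm (c *\<^sub>C x) \<le> norm x * cmod c" for x :: 'a
    by (simp add: norm_scaleC)
qed (rule scaleC_add_right)

lemmas tendsto_cinner = bounded_bilinear.tendsto[OF bounded_bilinear_cinner]
lemmas tendsto_scaleC = bounded_linear.tendsto[OF bounded_linear_scaleC]

lemma eq_zero_if_cinner_zero: "x = 0" if "\<And>y. cinner x y = 0" for x :: "'a::complex_hilbert"
  using Re_cinner_self[of x] that[of x] by simp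

lemma cinner_eqI: "x = y" if "\<And>z. cinner x z = cinner y z" for x y :: "'a::complex_hilbert"
  using eq_zero_if_cinner_zero[of "x - y"] that by (simp add: cinner_simps)


section \<open>Riesz representation and its consequences\<close>

text \<open>The energy \<open>\<parallel>y\<parallel>\<^sup>2 - 2 f y\<close> is bounded below, and by the parallelogram law its minimising
  sequences in \<open>M\<close> are Cauchy; the minimiser represents \<open>f\<close>. The choice \<open>M = UNIV\<close> gives the
  representation theorem, while \<open>f = Re \<langle>-, y\<rangle>\<close> gives the orthogonal projection of \<open>y\<close> onto \<open>M\<close>.\<close>

lemma riesz_closed_subspace:
  fixes f :: "'a::complex_hilbert \<Rightarrow> real"
  assumes f: "bounded_linear f" and M: "subspace M" "closed M"
  obtains x where "x \<in> M" "\<And>v. v \<in> M \<Longrightarrow> Re (cinner v x) = f v"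
proof -
  interpret f: bounded_linear f by (rule f)
  define J where "J = (\<lambda>y. (norm y)\<^sup>2 - 2 * f y)"
  obtain B where B: "\<And>y. \<bar>f y\<bar> \<le> norm y * B"
    using f.bounded by auto
  have lower: "- (B\<^sup>2) \<le> J y" for y
  proof -
    have "0 \<le> (norm y - B)\<^sup>2" by simp
    also have "\<dots> = (norm y)\<^sup>2 - 2 * (norm y * B) + B\<^sup>2" by (simp add: power2_diff)
    finally show ?thesis using B[of y] by (simp add: J_def)
  qed
  define m where "m = Inf (J ` M)"
  have ne: "J ` M \<noteq> {}" using subspace_0[OF M(1)] by blast
  have bdd: "bdd_below (J ` M)" using lower by (intro bdd_belowI2[of _ "- (B\<^sup>2)"]) simp
  have m_le: "m \<le> J y" if "y \<in> M" for y
    unfolding m_def using that bdd by (intro cInf_lower) auto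
  have "\<exists>y\<in>M. J y < m + 1 / real (Suc n)" for n
    using cInf_lessD[OF ne, of "m + 1 / real (Suc n)"] by (auto simp: m_def)
  then obtain y where yM: "\<And>n. y n \<in> M" and Jy: "\<And>n. J (y n) < m + 1 / real (Suc n)"
    by metis
  have parallelogram: "(norm (u - v))\<^sup>2 = 2 * J u + 2 * J v - 4 * J ((1/2) *\<^sub>R (u + v))" for u v
    by (simp add: J_def norm_add_squared norm_diff_squared f.scaleR f.add cinner_simps field_simps)
  have close: "(norm (y i - y j))\<^sup>2 \<le> 2 / real (Suc i) + 2 / real (Suc j)" for i j
  proof -
    have "m \<le> J ((1/2) *\<^sub>R (y i + y j))"
      by (intro m_le subspace_scale subspace_add M(1) yM)
    then show ?thesis
      using Jy[of i] Jy[of j] parallelogram[of "y i" "y j"] by simp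
  qed
  have "Cauchy y"
  proof (rule metric_CauchyI)
    fix e :: real assume e: "e > 0"
    obtain N where N: "4 / e\<^sup>2 < real N" using reals_Archimedean2 by blast
    have "dist (y i) (y j) < e" if "i \<ge> N" "j \<ge> N" for i j
    proof -
      have "N > 0" using N e by (cases N) (auto simp: divide_less_0_iff)
      then have "2 / real (Suc i) + 2 / real (Suc j) \<le> 2 / real N + 2 / real N"
        using that by (intro add_mono divide_left_mono) auto
      also have "\<dots> < e\<^sup>2" using N e \<open>N > 0\<close> by (simp add: field_simps)
      finally have "(norm (y i - y j))\<^sup>2 < e\<^sup>2" using close[of i j] by linarith
      then show ?thesis unfolding dist_norm using e by (intro power2_less_imp_less[of _ e]) auto
    qed
    then show "\<exists>N. \<forall>i\<ge>N. \<forall>j\<ge>N. dist (y i) (y j) < e" by blast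
  qed
  then obtain x where x: "y \<longlonglongrightarrow> x"
    using Cauchy_convergent_iff convergent_def by blast
  have xM: "x \<in> M" using M(2) yM x by (rule closed_sequentially)
  have "(\<lambda>n. J (y n)) \<longlonglongrightarrow> J x"
    unfolding J_def by (intro tendsto_intros f.tendsto x)
  moreover have "(\<lambda>n. m + 1 / real (Suc n)) \<longlonglongrightarrow> m + 0"
    using LIMSEQ_inverse_real_of_nat by (intro tendsto_intros) (simp add: inverse_eq_divide)
  ultimately have "J x \<le> m + 0"
    by (rule LIMSEQ_le) (use Jy less_imp_le in blast)
  then have min: "J x \<le> J z" if "z \<in> M" for z using m_le[OF that] by simp
  have "Re (cinner v x) = f v" if v: "v \<in> M" for v
  proof -
    define a where "a = Re (cinner x v) - f v"
    define s where "s = (norm v)\<^sup>2 + 1"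
    have s: "s \<ge> 1" by (simp add: s_def)
    \<comment> \<open>Any small step against the slope \<open>2 a\<close> would do; dividing by \<open>\<parallel>v\<parallel>\<^sup>2 + 1\<close> keeps the
      quadratic term below the linear one, also for \<open>v = 0\<close>.\<close>
    define t where "t = - a / s"
    have "J x \<le> J (x + t *\<^sub>R v)"
      by (intro min subspace_add subspace_scale M(1) xM v)
    also have "\<dots> = J x + 2 * t * a + t\<^sup>2 * (s - 1)"
      by (simp add: J_def norm_add_squared cinner_simps f.add f.scaleR a_def s_def
          power_mult_distrib algebra_simps)
    finally have "0 \<le> 2 * t * a + t\<^sup>2 * (s - 1)" by simp
    also have "\<dots> = - (a\<^sup>2 * (s + 1) / s\<^sup>2)"
      using s by (simp add: t_def field_simps power2_eq_square)
    finally have "a\<^sup>2 * (s + 1) / s\<^sup>2 \<le> 0" by simp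
    then have "a\<^sup>2 * (s + 1) \<le> 0" using s by (simp add: divide_le_0_iff)
    then have "a = 0" using s by (simp add: mult_le_0_iff)
    then show ?thesis using Re_cinner_commute[of v x] by (simp add: a_def)
  qed
  with xM show ?thesis by (rule that)
qed

text \<open>A complex-linear functional is determined by its real part: \<open>Im (g x) = - Re (g (\<i> x))\<close>.\<close>

lemma riesz_representation:
  fixes g :: "'a::complex_hilbert \<Rightarrow> complex"
  assumes g: "bounded_linear g" "\<And>c x. g (c *\<^sub>C x) = c * g x"
  obtains z where "\<And>x. g x = cinner x z"
proof -
  have "bounded_linear (\<lambda>x. Re (g x))"
    using bounded_linear_compose[OF bounded_linear_Re g(1)] .
  then obtain z where z: "\<And>v. Re (cinner v z) = Re (g v)"
    using riesz_closed_subspace[of "\<lambda>x. Re (g x)" UNIV] by auto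
  have "g x = cinner x z" for x
    using z[of x] z[of "\<i> *\<^sub>C x"] by (simp add: complex_eq_iff g(2) cinner_scaleC_left)
  then show ?thesis by (rule that)
qed

lemma bounded_clinear_bounded_linear: "bounded_clinear T \<Longrightarrow> bounded_linear T"
  by (simp add: bounded_clinear_def)

lemma bounded_clinear_scaleC: "bounded_clinear T \<Longrightarrow> T (c *\<^sub>C x) = c *\<^sub>C T x"
  by (simp add: bounded_clinear_def)

lemma bounded_adjoint_exists:
  assumes T: "bounded_clinear T"
  obtains z where "\<And>x. cinner (T x) y = cinner x z"
proof -
  have "bounded_linear (\<lambda>x. cinner (T x) y)"
    using bounded_bilinear.bounded_linear_left[OF bounded_bilinear_cinner]
      bounded_clinear_bounded_linear[OF T] by (rule bounded_linear_compose)
  then show ?thesis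
    using riesz_representation[of "\<lambda>x. cinner (T x) y"] that
    by (auto simp: bounded_clinear_scaleC[OF T] cinner_scaleC_left)
qed

text \<open>Moving \<open>T\<close> to the other entry of the inner product turns weak convergence of \<open>T (u n)\<close>
  into that of \<open>u n\<close>.\<close>

lemma bounded_clinear_weakly_continuous:
  assumes T: "bounded_clinear T" and u: "\<And>z. (\<lambda>n. cinner (u n) z) \<longlonglongrightarrow> cinner l z"
  shows "(\<lambda>n. cinner (T (u n)) y) \<longlonglongrightarrow> cinner (T l) y"
proof -
  obtain z where "\<And>x. cinner (T x) y = cinner x z" using bounded_adjoint_exists[OF T] by blast
  then show ?thesis using u by simp
qed

lemma orthogonal_to_proper_closed_subspace:
  fixes M :: "'a::complex_hilbert set"
  assumes M: "subspace M" "closed M" and C: "\<And>c v. v \<in> M \<Longrightarrow> c *\<^sub>C v \<in> M" and y: "y \<notin> M"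
  shows "\<exists>g. g \<noteq> 0 \<and> (\<forall>v\<in>M. cinner v g = 0)"
proof -
  have "bounded_linear (\<lambda>v. Re (cinner v y))"
    using bounded_linear_Re bounded_bilinear.bounded_linear_left[OF bounded_bilinear_cinner]
    by (rule bounded_linear_compose)
  then obtain x where x: "x \<in> M" "\<And>v. v \<in> M \<Longrightarrow> Re (cinner v x) = Re (cinner v y)"
    using riesz_closed_subspace[OF _ M] by blast
  have "cinner v (y - x) = 0" if "v \<in> M" for v
    using x(2)[OF that] x(2)[OF C[OF that, of \<i>]]
    by (simp add: complex_eq_iff cinner_scaleC_left cinner_simps)
  moreover have "y - x \<noteq> 0" using x(1) y by auto
  ultimately show ?thesis by blast
qed


section \<open>Sequential compactness in the weak operator topology\<close>

lemma separable_countable_dense: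
  assumes "separable_space (euclidean :: 'a::topological_space topology)"
  obtains d :: "nat \<Rightarrow> 'a::topological_space" where "closure (range d) = UNIV"
proof -
  obtain S :: "'a set" where S: "countable S" "closure S = UNIV"
    using assms unfolding separable_space_def by auto
  then have "S \<noteq> {}" by auto
  then have "range (from_nat_into S) = S" using S(1) by (rule range_from_nat_into)
  with S(2) that show ?thesis by metis
qed

text \<open>A diagonal argument, obtained here from Tychonoff's theorem: a countable product of discs is
  compact and metrizable.\<close>

lemma pointwise_bounded_convergent_subsequence:
  fixes g :: "nat \<Rightarrow> nat \<Rightarrow> complex"
  assumes "\<And>n i. cmod (g n i) \<le> b i"
  obtains r :: "nat \<Rightarrow> nat" where "strict_mono r" "\<And>i. convergent (\<lambda>n. g (r n) i)"
proof -
  have "compactin (product_topology (\<lambda>_::nat. euclidean) UNIV) (PiE UNIV (\<lambda>i. cball (0::complex) (b i)))"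
    by (simp add: compactin_PiE)
  then have "seq_compact (PiE UNIV (\<lambda>i. cball (0::complex) (b i)))"
    by (simp add: euclidean_product_topology compact_eq_seq_compact_metric)
  moreover have "\<forall>n. g n \<in> PiE UNIV (\<lambda>i. cball (0::complex) (b i))"
    using assms by auto
  ultimately obtain l r where r: "strict_mono (r::nat \<Rightarrow> nat)" and l: "(g \<circ> r) \<longlonglongrightarrow> l"
    unfolding seq_compact_def by metis
  have "limitin (product_topology (\<lambda>_::nat. euclidean) UNIV) (g \<circ> r) l sequentially"
    using l by (simp add: euclidean_product_topology)
  then have "(\<lambda>n. g (r n) i) \<longlonglongrightarrow> l i" for i
    by (simp add: limitin_componentwise)
  then show ?thesis using that[OF r] convergentI by blast
qed

text \<open>The Riesz representation in the second entry yields the operator pointwise. Its linearity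
  passes from the form because the inner product separates vectors.\<close>

lemma bounded_sesquilinear_form_operator:
  fixes L :: "'a::complex_hilbert \<Rightarrow> 'a \<Rightarrow> complex"
  assumes "\<And>x x' y. L (x + x') y = L x y + L x' y" "\<And>c x y. L (c *\<^sub>C x) y = c * L x y"
    and "\<And>x y y'. L x (y + y') = L x y + L x y'" "\<And>c x y. L x (c *\<^sub>C y) = cnj c * L x y"
    and bound: "\<And>x y. cmod (L x y) \<le> M * norm x * norm y"
  obtains S where "bounded_clinear S" "\<And>x y. L x y = cinner (S x) y"
proof -
  have "\<exists>z. \<forall>y. L x y = cinner z y" for x
  proof -
    have "bounded_linear (\<lambda>y. cnj (L x y))"
    proof (rule bounded_linear_intro)
      show "cnj (L x (r *\<^sub>R y)) = r *\<^sub>R cnj (L x y)" for r y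
        using assms(4)[of x "complex_of_real r" y]
        by (simp add: scaleC_of_real scaleR_conv_of_real)
      show "cmod (cnj (L x y)) \<le> norm y * (M * norm x)" for y
        using bound[of x y] by (simp add: mult.commute)
    qed (simp add: assms(3))
    then obtain z where "\<And>y. cnj (L x y) = cinner y z"
      using riesz_representation[of "\<lambda>y. cnj (L x y)"] by (auto simp: assms(4))
    then have "L x y = cinner z y" for y
      by (metis cinner_commute complex_cnj_cnj)
    then show ?thesis by blast
  qed
  then obtain S where S: "\<And>x y. L x y = cinner (S x) y" by metis
  have add: "S (x + x') = S x + S x'" for x x'
    by (rule cinner_eqI) (simp add: S[symmetric] assms(1) cinner_add_left)
  have scale: "S (c *\<^sub>C x) = c *\<^sub>C S x" for c x
    by (rule cinner_eqI) (simp add: S[symmetric] assms(2) cinner_scaleC_left)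
  have "norm (S x) \<le> norm x * M" for x
  proof (cases "S x = 0")
    case True
    have "0 \<le> cmod (L x x)" by simp
    also have "\<dots> \<le> M * norm x * norm x" by (rule bound)
    finally show ?thesis using True
      by (cases "x = 0") (auto simp: zero_le_mult_iff)
  next
    case False
    have "(norm (S x))\<^sup>2 \<le> cmod (L x (S x))"
      by (simp add: S cinner_norm norm_power)
    also have "\<dots> \<le> M * norm x * norm (S x)" by (rule bound)
    finally show ?thesis using False by (simp add: power2_eq_square mult.commute)
  qed
  then have "bounded_linear S"
    using add scale[of "complex_of_real r" for r]
    by (intro bounded_linear_intro) (auto simp: scaleC_of_real)
  with scale S show ?thesis by (intro that) (auto simp: bounded_clinear_def)
qed

text \<open>Matrix elements between vectors of a countable dense set converge along a subsequence. The
  uniform bound makes the matrix elements equicontinuous, so convergence extends to all pairs of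
  vectors. The limits form a bounded sesquilinear form, hence an operator.\<close>

lemma uniformly_bounded_weakly_convergent_subsequence:
  fixes T :: "nat \<Rightarrow> 'a::complex_hilbert \<Rightarrow> 'a"
  assumes separable: "separable_space (euclidean :: 'a topology)"
    and T: "\<And>n. bounded_clinear (T n)" and b: "\<And>n x. norm (T n x) \<le> M * norm x"
  shows "\<exists>r S. strict_mono (r :: nat \<Rightarrow> nat) \<and> bounded_clinear S \<and>
    (\<forall>x y. (\<lambda>n. cinner (T (r n) x) y) \<longlonglongrightarrow> cinner (S x) y)"
proof -
  have T_diff: "T n (x - y) = T n x - T n y" and T_add: "T n (x + y) = T n x + T n y" for n x y
    using bounded_clinear_bounded_linear[OF T[of n]]
    by (simp_all add: bounded_linear.linear linear_diff linear_add)
  have bound: "cmod (cinner (T n x) y) \<le> M * norm x * norm y" for n x y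
    using cauchy_schwarz[of "T n x" y] mult_right_mono[OF b[of n x] norm_ge_zero[of y]]
    by linarith
  obtain d :: "nat \<Rightarrow> 'a" where d: "closure (range d) = UNIV"
    using separable_countable_dense[OF separable] by blast
  define e1 where "e1 i = d (fst (prod_decode i))" for i
  define e2 where "e2 i = d (snd (prod_decode i))" for i
  obtain r :: "nat \<Rightarrow> nat" where r: "strict_mono r"
    and conv: "\<And>i. convergent (\<lambda>n. cinner (T (r n) (e1 i)) (e2 i))"
    by (rule pointwise_bounded_convergent_subsequence[of "\<lambda>n i. cinner (T n (e1 i)) (e2 i)"
          "\<lambda>i. M * norm (e1 i) * norm (e2 i)"]) (use bound in blast)+
  have conv_d: "convergent (\<lambda>n. cinner (T (r n) (d i)) (d j))" for i j
    using conv[of "prod_encode (i, j)"] by (simp add: e1_def e2_def)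
  have "Cauchy (\<lambda>n. cinner (T (r n) x) y)" for x y
  proof (rule metric_CauchyI)
    fix e :: real assume e: "e > 0"
    have "x \<in> closure (range d)" "y \<in> closure (range d)" using d by simp_all
    then obtain xs ys where xs: "\<And>k. xs k \<in> range d" "xs \<longlonglongrightarrow> x"
      and ys: "\<And>k. ys k \<in> range d" "ys \<longlonglongrightarrow> y"
      unfolding closure_sequential by blast
    define h where "h k = M * norm (x - xs k) * norm y + M * norm (xs k) * norm (y - ys k)" for k
    have approx: "dist (cinner (T n x) y) (cinner (T n (xs k)) (ys k)) \<le> h k" for n k
    proof -
      have "cinner (T n x) y - cinner (T n (xs k)) (ys k)
          = cinner (T n (x - xs k)) y + cinner (T n (xs k)) (y - ys k)"
        by (simp add: T_diff cinner_simps)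
      then show ?thesis unfolding dist_norm h_def
        using norm_triangle_ineq[of "cinner (T n (x - xs k)) y" "cinner (T n (xs k)) (y - ys k)"]
          bound[of n "x - xs k" y] bound[of n "xs k" "y - ys k"] by simp
    qed
    have "h \<longlonglongrightarrow> M * norm (x - x) * norm y + M * norm x * norm (y - y)"
      unfolding h_def by (intro tendsto_intros xs ys)
    then have "\<forall>\<^sub>F k in sequentially. h k < e / 3"
      using e by (intro order_tendstoD(2)) auto
    then obtain k where k: "h k < e / 3" by (auto simp: eventually_sequentially)
    obtain i j where "xs k = d i" "ys k = d j" using xs(1)[of k] ys(1)[of k] by auto
    then have "Cauchy (\<lambda>n. cinner (T (r n) (xs k)) (ys k))"
      using conv_d by (simp add: Cauchy_convergent_iff)
    then obtain N where N: "\<And>m n. m \<ge> N \<Longrightarrow> n \<ge> N \<Longrightarrow>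
        dist (cinner (T (r m) (xs k)) (ys k)) (cinner (T (r n) (xs k)) (ys k)) < e / 3"
      using e unfolding Cauchy_def by (meson divide_pos_pos zero_less_numeral)
    have "dist (cinner (T (r m) x) y) (cinner (T (r n) x) y) < e" if "m \<ge> N" "n \<ge> N" for m n
    proof -
      have "dist (cinner (T (r m) x) y) (cinner (T (r n) x) y)
          \<le> dist (cinner (T (r m) x) y) (cinner (T (r m) (xs k)) (ys k))
            + dist (cinner (T (r m) (xs k)) (ys k)) (cinner (T (r n) (xs k)) (ys k))
            + dist (cinner (T (r n) x) y) (cinner (T (r n) (xs k)) (ys k))"
        by metric
      then show ?thesis
        using N[OF that] k approx[of "r m" k] approx[of "r n" k] by linarith
    qed
    then show "\<exists>N. \<forall>m\<ge>N. \<forall>n\<ge>N. dist (cinner (T (r m) x) y) (cinner (T (r n) x) y) < e" by blast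
  qed
  then have "\<forall>x y. \<exists>l. (\<lambda>n. cinner (T (r n) x) y) \<longlonglongrightarrow> l"
    by (simp add: Cauchy_convergent_iff convergent_def)
  then obtain L where L: "\<And>x y. (\<lambda>n. cinner (T (r n) x) y) \<longlonglongrightarrow> L x y" by metis
  obtain S where S: "bounded_clinear S" and LS: "\<And>x y. L x y = cinner (S x) y"
  proof (rule bounded_sesquilinear_form_operator[of L M])
    show "L (x + x') y = L x y + L x' y" for x x' y
      using L[of "x + x'" y] tendsto_add[OF L[of x y] L[of x' y]]
      by (intro LIMSEQ_unique[of _ "L (x + x') y"]) (auto simp: T_add cinner_simps)
    show "L (c *\<^sub>C x) y = c * L x y" for c x y
      using L[of "c *\<^sub>C x" y] tendsto_mult_left[OF L[of x y], of c]
      by (intro LIMSEQ_unique[of _ "L (c *\<^sub>C x) y"])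
        (auto simp: bounded_clinear_scaleC[OF T] cinner_scaleC_left)
    show "L x (y + y') = L x y + L x y'" for x y y'
      using L[of x "y + y'"] tendsto_add[OF L[of x y] L[of x y']]
      by (intro LIMSEQ_unique[of _ "L x (y + y')"]) (auto simp: cinner_simps)
    show "L x (c *\<^sub>C y) = cnj c * L x y" for c x y
      using L[of x "c *\<^sub>C y"] tendsto_mult_left[OF L[of x y], of "cnj c"]
      by (intro LIMSEQ_unique[of _ "L x (c *\<^sub>C y)"]) (auto simp: cinner_scaleC_right)
    show "cmod (L x y) \<le> M * norm x * norm y" for x y
      by (rule LIMSEQ_le_const2[OF tendsto_norm[OF L]]) (use bound in blast)
  qed blast
  show ?thesis
    using r S L unfolding LS by (intro exI[of _ r] exI[of _ S]) simp
qed


section \<open>Bounded operators prescribed on a dense range\<close>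

text \<open>This form of density is convenient for linear maps: limits of images are combined by combining
  the preimages.\<close>

lemma closure_range_sequential:
  fixes f :: "'b \<Rightarrow> 'a::metric_space"
  shows "x \<in> closure (range f) \<longleftrightarrow> (\<exists>a. (\<lambda>n. f (a n)) \<longlonglongrightarrow> x)"
proof
  assume "x \<in> closure (range f)"
  then obtain u where u: "\<And>n. u n \<in> range f" "u \<longlonglongrightarrow> x"
    unfolding closure_sequential by blast
  then have "(\<lambda>n. f (inv f (u n))) \<longlonglongrightarrow> x" by (simp add: f_inv_into_f)
  then show "\<exists>a. (\<lambda>n. f (a n)) \<longlonglongrightarrow> x" by (rule exI[of _ "\<lambda>n. inv f (u n)"])
next
  assume "\<exists>a. (\<lambda>n. f (a n)) \<longlonglongrightarrow> x"
  then obtain a where "(\<lambda>n. f (a n)) \<longlonglongrightarrow> x" by (rule exE)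
  then show "x \<in> closure (range f)"
    unfolding closure_sequential by (intro exI[of _ "\<lambda>n. f (a n)"]) simp
qed

text \<open>The bound makes \<open>K f\<close> depend only on \<open>R f\<close>, and in a Lipschitz way; the resulting map on the
  range of \<open>R\<close> extends to the closure by uniform continuity, and linearity persists in the limit.\<close>

lemma bounded_clinear_factor_through_dense_range:
  fixes R K :: "'a::complex_hilbert \<Rightarrow> 'a"
  assumes R: "bounded_clinear R" and K: "bounded_clinear K"
    and dense: "closure (range R) = UNIV" and bound: "\<And>f. norm (K f) \<le> b * norm (R f)"
  obtains D where "bounded_clinear D" "\<And>f. D (R f) = K f"
proof -
  interpret R: bounded_linear R using R by (rule bounded_clinear_bounded_linear)
  interpret K: bounded_linear K using K by (rule bounded_clinear_bounded_linear)
  \<comment> \<open>A Lipschitz constant must be nonnegative, and \<open>b\<close> need not be (in the trivial space).\<close>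
  have b: "norm (K f) \<le> \<bar>b\<bar> * norm (R f)" for f
    using bound[of f] mult_right_mono[OF abs_ge_self[of b] norm_ge_zero[of "R f"]] by linarith
  define h where "h u = K (inv R u)" for u
  have "dist (h u) (h v) \<le> \<bar>b\<bar> * dist u v" if "u \<in> range R" "v \<in> range R" for u v
    using b[of "inv R u - inv R v"] that
    by (simp add: h_def dist_norm K.diff R.diff f_inv_into_f)
  then have "\<bar>b\<bar>-lipschitz_on (range R) h" by (intro lipschitz_onI) auto
  then have "uniformly_continuous_on (range R) h"
    by (rule lipschitz_on_uniformly_continuous)
  then obtain D where "uniformly_continuous_on (closure (range R)) D"
    and hD: "\<And>u. u \<in> range R \<Longrightarrow> h u = D u"
  proof (rule uniformly_continuous_on_extension_on_closure)
    fix g assume g: "uniformly_continuous_on (closure (range R)) g" "\<And>u. u \<in> range R \<Longrightarrow> h u = g u"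
    show thesis by (rule that[OF g])
  qed
  then have "continuous_on UNIV D"
    using dense uniformly_continuous_imp_continuous by metis
  then have D_lim: "(\<lambda>n. D (u n)) \<longlonglongrightarrow> D x" if "u \<longlonglongrightarrow> x" for u :: "nat \<Rightarrow> 'a" and x
    using that by (auto intro: isCont_tendsto_compose simp: continuous_on_eq_continuous_at)
  have DR: "D (R f) = K f" for f
    using b[of "inv R (R f) - f"] hD[of "R f"]
    by (simp add: h_def K.diff R.diff f_inv_into_f)
  have approx: "\<exists>a. (\<lambda>n. R (a n)) \<longlonglongrightarrow> x" for x
    using dense closure_range_sequential[of x R] by simp
  have add: "D (x + y) = D x + D y" for x y
  proof -
    obtain a c where "(\<lambda>n. R (a n)) \<longlonglongrightarrow> x" "(\<lambda>n. R (c n)) \<longlonglongrightarrow> y" using approx by metis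
    from D_lim[OF tendsto_add[OF this]] tendsto_add[OF this[THEN D_lim]] show ?thesis
      by (intro LIMSEQ_unique[of _ "D (x + y)"]) (auto simp: R.add[symmetric] DR K.add)
  qed
  have scale: "D (c *\<^sub>C x) = c *\<^sub>C D x" for c x
  proof -
    obtain a where "(\<lambda>n. R (a n)) \<longlonglongrightarrow> x" using approx by metis
    from D_lim[OF tendsto_scaleC[OF this, of c]] tendsto_scaleC[OF D_lim[OF this], of c]
    show ?thesis
      by (intro LIMSEQ_unique[of _ "D (c *\<^sub>C x)"])
        (auto simp: bounded_clinear_scaleC[OF R, symmetric] DR bounded_clinear_scaleC[OF K])
  qed
  have "norm (D x) \<le> norm x * \<bar>b\<bar>" for x
  proof -
    obtain a where a: "(\<lambda>n. R (a n)) \<longlonglongrightarrow> x" using approx by metis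
    show ?thesis
      by (rule LIMSEQ_le[OF tendsto_norm[OF D_lim[OF a]] tendsto_mult_right[OF tendsto_norm[OF a]]])
        (use b in \<open>auto simp: DR mult.commute\<close>)
  qed
  then have "bounded_linear D"
    using add scale[of "complex_of_real r" for r]
    by (intro bounded_linear_intro) (auto simp: scaleC_of_real)
  with scale DR show ?thesis by (intro that) (auto simp: bounded_clinear_def)
qed


section \<open>Coercive perturbations of m-accretive operators\<close>

lemma plus_op_iff: "(x, z) \<in> plus_op T A \<longleftrightarrow> (x, z - T x) \<in> A"
  unfolding plus_op_def by (auto simp: algebra_simps intro!: exI[of _ "z - T x"])

lemma linear_operator_scaleR: "linear_operator A \<Longrightarrow> (x, y) \<in> A \<Longrightarrow> (r *\<^sub>R x, r *\<^sub>R y) \<in> A"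
  unfolding linear_operator_def by (metis scaleC_of_real)

lemma linear_operator_add:
  "linear_operator A \<Longrightarrow> (x, y) \<in> A \<Longrightarrow> (x', y') \<in> A \<Longrightarrow> (x + x', y + y') \<in> A"
  unfolding linear_operator_def by blast

lemma linear_operator_diff:
  "linear_operator A \<Longrightarrow> (x, y) \<in> A \<Longrightarrow> (x', y') \<in> A \<Longrightarrow> (x - x', y - y') \<in> A"
  using linear_operator_add[of A x y "- x'" "- y'"] linear_operator_scaleR[of A x' y' "-1"] by simp

lemma m_accretive_linear: "m_accretive A \<Longrightarrow> linear_operator A"
  by (simp add: m_accretive_def)

lemma m_accretive_Re: "m_accretive A \<Longrightarrow> (x, y) \<in> A \<Longrightarrow> Re (cinner y x) \<ge> 0"
  unfolding m_accretive_def by blast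

lemma coercive_norm_bound:
  assumes A: "m_accretive A" and T: "\<And>\<phi>. \<alpha> * (norm \<phi>)\<^sup>2 \<le> Re (cinner (T \<phi>) \<phi>)"
    and xz: "(x, z - T x) \<in> A"
  shows "\<alpha> * norm x \<le> norm z"
proof (cases "x = 0")
  case False
  have "\<alpha> * (norm x)\<^sup>2 \<le> Re (cinner z x)"
    using m_accretive_Re[OF A xz] T[of x] by (simp add: cinner_simps)
  also have "\<dots> \<le> norm z * norm x" using Re_cinner_le[of z x] by simp
  finally show ?thesis using False by (simp add: power2_eq_square)
qed simp

text \<open>Coercivity bounds \<open>T + A\<close> from below, so it is injective with closed range \<open>M\<close> and bounded inverse.
  A vector \<open>g\<close> orthogonal to the range lies in the domain of the adjoint of \<open>A\<close> with value
  \<open>- T\<^sup>* g\<close>; accretivity of the adjoint against coercivity of \<open>T\<close> forces \<open>g = 0\<close>. Hence the range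
  is everything.\<close>

lemma coercive_perturbation_boundedly_invertible:
  fixes A :: "'a::complex_hilbert op_graph"
  assumes A: "m_accretive A" and T: "bounded_clinear T"
    and \<alpha>: "\<alpha> > 0" and coercive: "\<And>\<phi>. \<alpha> * (norm \<phi>)\<^sup>2 \<le> Re (cinner (T \<phi>) \<phi>)"
  shows "boundedly_invertible (plus_op T A)"
proof -
  interpret T: bounded_linear T using T by (rule bounded_clinear_bounded_linear)
  note lin = m_accretive_linear[OF A]
  note bound = coercive_norm_bound[where T = T, OF A coercive]
  have zero: "(0, 0) \<in> A" using lin by (simp add: linear_operator_def)
  have add: "(x + x', (z + z') - T (x + x')) \<in> A"
    if "(x, z - T x) \<in> A" "(x', z' - T x') \<in> A" for x x' z z'
    using linear_operator_add[OF lin that] by (simp add: T.add algebra_simps)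
  have diff: "(x - x', (z - z') - T (x - x')) \<in> A"
    if "(x, z - T x) \<in> A" "(x', z' - T x') \<in> A" for x x' z z'
    using linear_operator_diff[OF lin that] by (simp add: T.diff algebra_simps)
  have scaleC: "(c *\<^sub>C x, c *\<^sub>C z - T (c *\<^sub>C x)) \<in> A" if "(x, z - T x) \<in> A" for c x z
  proof -
    have "(c *\<^sub>C x, c *\<^sub>C (z - T x)) \<in> A" using lin that by (simp add: linear_operator_def)
    then show ?thesis
      by (simp add: bounded_clinear_scaleC[OF T] bounded_linear.linear[OF bounded_linear_scaleC] linear_diff)
  qed
  have unique: "x = x'" if "(x, z - T x) \<in> A" "(x', z - T x') \<in> A" for x x' z
    using bound[OF diff[OF that]] \<alpha> by (simp add: mult_le_0_iff)
  define M where "M = {z. \<exists>x. (x, z - T x) \<in> A}"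
  have M_subspace: "subspace M"
  proof (rule subspaceI)
    show "0 \<in> M" using zero by (auto simp: M_def T.zero intro!: exI[of _ 0])
    show "v + w \<in> M" if "v \<in> M" "w \<in> M" for v w
      using that add unfolding M_def by blast
    show "r *\<^sub>R v \<in> M" if "v \<in> M" for r v
      using that scaleC[of _ v "complex_of_real r"] unfolding M_def scaleC_of_real by blast
  qed
  have M_closed: "closed M"
    unfolding closed_sequential_limits
  proof (intro allI impI, elim conjE)
    fix z l assume z: "\<forall>n. z n \<in> M" "z \<longlonglongrightarrow> l"
    then have "\<forall>n. \<exists>x. (x, z n - T x) \<in> A" by (simp add: M_def)
    then obtain x where x: "\<And>n. (x n, z n - T (x n)) \<in> A" by metis
    have "Cauchy x"
    proof (rule metric_CauchyI)
      fix e :: real assume e: "e > 0"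
      obtain N where N: "\<And>i j. i \<ge> N \<Longrightarrow> j \<ge> N \<Longrightarrow> dist (z i) (z j) < \<alpha> * e"
        using LIMSEQ_imp_Cauchy[OF z(2)] e \<alpha> unfolding Cauchy_def by (meson mult_pos_pos)
      have "dist (x i) (x j) < e" if "i \<ge> N" "j \<ge> N" for i j
      proof -
        have "\<alpha> * dist (x i) (x j) < \<alpha> * e"
          using N[OF that] bound[OF diff[OF x[of i] x[of j]]] by (simp add: dist_norm)
        then show ?thesis using \<alpha> by simp
      qed
      then show "\<exists>N. \<forall>i\<ge>N. \<forall>j\<ge>N. dist (x i) (x j) < e" by blast
    qed
    then obtain u where u: "x \<longlonglongrightarrow> u" using Cauchy_convergent_iff convergent_def by blast
    have "(\<lambda>n. (x n, z n - T (x n))) \<longlonglongrightarrow> (u, l - T u)"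
      by (intro tendsto_intros T.tendsto u z(2))
    moreover have "closed A" using A by (simp add: m_accretive_def)
    ultimately have "(u, l - T u) \<in> A"
      using closed_sequentially[of A "\<lambda>n. (x n, z n - T (x n))"] x by simp
    then show "l \<in> M" unfolding M_def by blast
  qed
  have M_scaleC: "c *\<^sub>C v \<in> M" if "v \<in> M" for c v
    using that scaleC unfolding M_def by blast
  have M_orth: "g = 0" if g: "\<And>v. v \<in> M \<Longrightarrow> cinner v g = 0" for g
  proof -
    obtain z where z: "\<And>x. cinner (T x) g = cinner x z" using bounded_adjoint_exists[OF T] by blast
    have "cinner w g = cinner x (- z)" if "(x, w) \<in> A" for x w
    proof -
      have "T x + w \<in> M" unfolding M_def using that by (auto intro!: exI[of _ x])
      from g[OF this] show ?thesis by (simp add: cinner_simps z eq_neg_iff_add_eq_0 add.commute)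
    qed
    then have "(g, - z) \<in> adjoint_op A" by (auto simp: adjoint_op_def)
    then have "Re (cinner (- z) g) \<ge> 0" using A unfolding m_accretive_def by blast
    then have "\<alpha> * (norm g)\<^sup>2 \<le> 0"
      using coercive[of g] Re_cinner_commute[of z g] by (simp add: cinner_simps z)
    then show "g = 0" using \<alpha> by (simp add: mult_le_0_iff)
  qed
  have "z \<in> M" for z
  proof (rule ccontr)
    assume "z \<notin> M"
    from M_subspace M_closed M_scaleC this
    have "\<exists>g. g \<noteq> 0 \<and> (\<forall>v\<in>M. cinner v g = 0)"
      by (rule orthogonal_to_proper_closed_subspace)
    then show False using M_orth by blast
  qed
  then have "\<forall>z. \<exists>x. (x, z - T x) \<in> A" by (simp add: M_def)
  then obtain R where R: "\<And>z. (R z, z - T (R z)) \<in> A" by metis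
  have R_eq: "R z = x" if "(x, z - T x) \<in> A" for x z using unique[OF R that] .
  have R_scale: "R (c *\<^sub>C z) = c *\<^sub>C R z" for c z by (intro R_eq scaleC R)
  have "bounded_linear R"
  proof (rule bounded_linear_intro)
    show "R (z + z') = R z + R z'" for z z' by (intro R_eq add R)
    show "R (r *\<^sub>R z) = r *\<^sub>R R z" for r z
      using R_scale[of "complex_of_real r" z] by (simp add: scaleC_of_real)
    show "norm (R z) \<le> norm z * (1 / \<alpha>)" for z
      using bound[OF R[of z]] \<alpha> by (simp add: field_simps)
  qed
  then have "bounded_clinear R" using R_scale by (simp add: bounded_clinear_def)
  moreover have "graph_of R = converse (plus_op T A)"
    using R R_eq by (auto simp: graph_of_def plus_op_iff)
  ultimately show ?thesis unfolding boundedly_invertible_def by blast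
qed

lemma inverse_plus_op_iff:
  assumes "boundedly_invertible (plus_op T A)"
  shows "inverse_op (plus_op T A) z = x \<longleftrightarrow> (x, z - T x) \<in> A"
proof -
  have "(z, x) \<in> graph_of (inverse_op (plus_op T A)) \<longleftrightarrow> (x, z) \<in> plus_op T A"
    unfolding inverse_op(2)[OF assms] by simp
  then show ?thesis by (auto simp: graph_of_def plus_op_iff)
qed

text \<open>The graph is recovered from the bounded operator \<open>J = (1 + A)\<^sup>-\<^sup>1\<close>: a pair \<open>(u, v)\<close> belongs to it
  iff \<open>J (u + v) = u\<close>, and this equation survives weak limits because \<open>J\<close> is weakly continuous.\<close>

lemma m_accretive_weakly_closed:
  assumes A: "m_accretive A" and uv: "\<And>n. (u n, v n) \<in> A"
    and u: "\<And>y. (\<lambda>n. cinner (u n) y) \<longlonglongrightarrow> cinner u' y"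
    and v: "\<And>y. (\<lambda>n. cinner (v n) y) \<longlonglongrightarrow> cinner v' y"
  shows "(u', v') \<in> A"
proof -
  define J where "J = inverse_op (plus_op (\<lambda>x. x) A)"
  have inv: "boundedly_invertible (plus_op (\<lambda>x. x) A)"
    by (rule coercive_perturbation_boundedly_invertible[OF A, where \<alpha> = 1])
      (auto simp: bounded_clinear_def bounded_linear_ident Re_cinner_self)
  have J: "bounded_clinear J" unfolding J_def using inverse_op(1)[OF inv] .
  have "J (u n + v n) = u n" for n
    unfolding J_def inverse_plus_op_iff[OF inv] using uv by simp
  then have lim: "(\<lambda>n. cinner (u n) y) \<longlonglongrightarrow> cinner (J (u' + v')) y" for y
    using bounded_clinear_weakly_continuous[OF J, of "\<lambda>n. u n + v n" "u' + v'" y]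
      tendsto_add[OF u v] by (simp add: cinner_simps)
  have "J (u' + v') = u'"
    by (rule cinner_eqI) (rule LIMSEQ_unique[OF lim u])
  then show ?thesis unfolding J_def inverse_plus_op_iff[OF inv] by simp
qed

text \<open>Coercivity is not obviously stable, since \<open>\<langle>q n, u n\<rangle>\<close> pairs two weakly convergent sequences.
  It is rescued by the equation \<open>q n + A (u n) = f\<close>, which trades this product for
  \<open>Re \<langle>f, u n\<rangle> - Re \<langle>A (u n), u n\<rangle>\<close>: a weakly continuous term, minus a nonnegative quadratic form.
  The auxiliary sequence \<open>w\<close> serves both inequalities at once, with \<open>w = u\<close> or \<open>w = q\<close>.\<close>

lemma coercivity_of_weak_limit:
  assumes A: "m_accretive A" and uq: "\<And>n. (u n, f - q n) \<in> A"
    and u: "\<And>y. (\<lambda>n. cinner (u n) y) \<longlonglongrightarrow> cinner u' y"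
    and uq': "(u', f - q') \<in> A"
    and q: "\<And>y. (\<lambda>n. cinner (q n) y) \<longlonglongrightarrow> cinner q' y"
    and w: "\<And>y. (\<lambda>n. cinner (w n) y) \<longlonglongrightarrow> cinner w' y"
    and s: "s \<ge> 0" and coercive: "\<And>n. s * (norm (w n))\<^sup>2 \<le> Re (cinner (q n) (u n))"
  shows "s * (norm w')\<^sup>2 \<le> Re (cinner q' u')"
proof -
  \<comment> \<open>Both \<open>s \<parallel>w n\<parallel>\<^sup>2\<close> and \<open>Re \<langle>A (u n), u n\<rangle>\<close> are replaced by their tangents at the limit, which lie
    below these convex functions and are affine, hence weakly continuous. So \<open>X n\<close> is a lower
    bound for \<open>Re \<langle>u n, f\<rangle>\<close> that converges.\<close>
  define X where "X n = s * (2 * Re (cinner (w n) w') - (norm w')\<^sup>2)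
      + (Re (cinner f u') - Re (cinner (q n) u')) + Re (cinner (u n) (f - q'))
      - Re (cinner (f - q') u')" for n
  have "X \<longlonglongrightarrow> s * (2 * Re (cinner w' w') - (norm w')\<^sup>2)
      + (Re (cinner f u') - Re (cinner q' u')) + Re (cinner u' (f - q')) - Re (cinner (f - q') u')"
    unfolding X_def by (intro tendsto_intros tendsto_Re u q w)
  moreover have "(\<lambda>n. Re (cinner (u n) f)) \<longlonglongrightarrow> Re (cinner u' f)"
    by (intro tendsto_Re u)
  moreover have "X n \<le> Re (cinner (u n) f)" for n
  proof -
    have "(u n - u', (f - q n) - (f - q')) \<in> A"
      using linear_operator_diff[OF m_accretive_linear[OF A] uq uq'] .
    from m_accretive_Re[OF A this]
    have "Re (cinner (f - q n) (u n)) \<ge> Re (cinner f u') - Re (cinner (q n) u')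
        + Re (cinner (u n) (f - q')) - Re (cinner (f - q') u')"
      using Re_cinner_commute[of "u n" f] Re_cinner_commute[of "u n" q']
      by (simp add: cinner_simps)
    moreover have "s * (2 * Re (cinner (w n) w') - (norm w')\<^sup>2) \<le> s * (norm (w n))\<^sup>2"
      using norm_diff_squared[of "w n" w'] zero_le_power2[of "norm (w n - w')"] s
      by (intro mult_left_mono) linarith+
    moreover have "Re (cinner (u n) f) = Re (cinner (q n) (u n)) + Re (cinner (f - q n) (u n))"
      using Re_cinner_commute[of "u n" f] by (simp add: cinner_simps)
    ultimately show ?thesis using coercive[of n] unfolding X_def by linarith
  qed
  ultimately have "s * (2 * Re (cinner w' w') - (norm w')\<^sup>2)
      + (Re (cinner f u') - Re (cinner q' u')) + Re (cinner u' (f - q')) - Re (cinner (f - q') u')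
      \<le> Re (cinner u' f)"
    by (intro LIMSEQ_le[of X]) auto
  then show ?thesis
    using Re_cinner_commute[of u' f] Re_cinner_commute[of u' q']
    by (simp add: cinner_simps Re_cinner_self)
qed


section \<open>Weak limits of resolvents\<close>

lemma cocoercive_norm_bound:
  assumes "\<beta> > 0" and q: "1 / \<beta> * (norm q)\<^sup>2 \<le> Re (cinner q u)"
  shows "norm q \<le> \<beta> * norm u"
proof (cases "q = 0")
  case True
  then show ?thesis using assms(1) by simp
next
  case False
  have "1 / \<beta> * (norm q)\<^sup>2 \<le> norm q * norm u"
    using q Re_cinner_le[of q u] by linarith
  then show ?thesis using False assms(1) by (simp add: power2_eq_square field_simps)
qed

text \<open>A vector \<open>g\<close> orthogonal to the range is in particular orthogonal to \<open>R g\<close>.\<close>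

lemma closure_range_eq_UNIV:
  fixes R :: "'a::complex_hilbert \<Rightarrow> 'a"
  assumes R: "bounded_clinear R" and orth: "\<And>f. cinner (R f) f = 0 \<Longrightarrow> f = 0"
  shows "closure (range R) = UNIV"
proof (rule ccontr)
  interpret R: bounded_linear R using R by (rule bounded_clinear_bounded_linear)
  assume "closure (range R) \<noteq> UNIV"
  then obtain y where y: "y \<notin> closure (range R)" by blast
  have scaleC: "c *\<^sub>C v \<in> closure (range R)" if v: "v \<in> closure (range R)" for c v
  proof -
    obtain a where "(\<lambda>n. R (a n)) \<longlonglongrightarrow> v"
      using v unfolding closure_range_sequential by (elim exE)
    then have "(\<lambda>n. R (c *\<^sub>C a n)) \<longlonglongrightarrow> c *\<^sub>C v"
      unfolding bounded_clinear_scaleC[OF R] by (rule tendsto_scaleC)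
    then show ?thesis
      unfolding closure_range_sequential by (rule exI[of _ "\<lambda>n. c *\<^sub>C a n"])
  qed
  have sub: "subspace (closure (range R))"
  proof (rule subspaceI)
    show "0 \<in> closure (range R)"
      using closure_subset[of "range R"] R.zero by (metis rangeI subsetD)
    show "v + w \<in> closure (range R)" if vw: "v \<in> closure (range R)" "w \<in> closure (range R)" for v w
    proof -
      obtain a c where "(\<lambda>n. R (a n)) \<longlonglongrightarrow> v" "(\<lambda>n. R (c n)) \<longlonglongrightarrow> w"
        using vw unfolding closure_range_sequential by (elim exE)
      then have "(\<lambda>n. R (a n + c n)) \<longlonglongrightarrow> v + w" unfolding R.add by (rule tendsto_add)
      then show ?thesis
        unfolding closure_range_sequential by (rule exI[of _ "\<lambda>n. a n + c n"])
    qed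
    show "r *\<^sub>R v \<in> closure (range R)" if v: "v \<in> closure (range R)" for r v
      using scaleC[OF v, of "complex_of_real r"] by (simp add: scaleC_of_real)
  qed
  from sub closed_closure scaleC y
  have "\<exists>g. g \<noteq> 0 \<and> (\<forall>v\<in>closure (range R). cinner v g = 0)"
    by (rule orthogonal_to_proper_closed_subspace)
  then obtain g where g: "g \<noteq> 0" "\<forall>v\<in>closure (range R). cinner v g = 0" by blast
  have "R g \<in> closure (range R)" using closure_subset[of "range R"] by blast
  with g orth show False by blast
qed

theorem corollary2p11:
  fixes A0 A :: "('a::complex_hilbert \<times> 'a) set"
    and C :: "nat \<Rightarrow> 'a \<Rightarrow> 'a"
    and \<alpha> \<beta> :: real
  assumes separable: "separable_space (euclidean :: 'a topology)"
    and A0: "linear_operator A0" "densely_defined A0" "closed A0" "skew_symmetric A0"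
    and A: "m_accretive A" "A0 \<subseteq> A" "A \<subseteq> minus_op (adjoint_op A0)"
    and \<alpha>\<beta>: "\<beta> > \<alpha>" "\<alpha> > 0"
    and C_bounded: "\<And>n. bounded_clinear (C n)"
    and C_ineq: "\<And>n \<phi>. Re (cinner (C n \<phi>) \<phi>) \<ge>
                   max (\<alpha> * (norm \<phi>)\<^sup>2) (1 / \<beta> * (norm (C n \<phi>))\<^sup>2)"
  shows "(\<forall>n. boundedly_invertible (plus_op (C n) A)) \<and>
    (\<exists>r D. strict_mono (r :: nat \<Rightarrow> nat) \<and> bounded_clinear D \<and>
       (\<forall>\<phi>. Re (cinner (D \<phi>) \<phi>) \<ge> max (\<alpha> * (norm \<phi>)\<^sup>2) (1 / \<beta> * (norm (D \<phi>))\<^sup>2)) \<and>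
       boundedly_invertible (plus_op D A) \<and>
       limitin weak_operator_topology
         (\<lambda>k. inverse_op (plus_op (C (r k)) A)) (inverse_op (plus_op D A)) sequentially)"
proof -
  have \<beta>: "\<beta> > 0" using \<alpha>\<beta> by simp
  have C_coercive: "\<alpha> * (norm \<phi>)\<^sup>2 \<le> Re (cinner (C n \<phi>) \<phi>)"
    and C_cocoercive: "1 / \<beta> * (norm (C n \<phi>))\<^sup>2 \<le> Re (cinner (C n \<phi>) \<phi>)" for n \<phi>
    using C_ineq[where n = n and \<phi> = \<phi>] by simp_all
  have inv: "boundedly_invertible (plus_op (C n) A)" for n
    by (rule coercive_perturbation_boundedly_invertible[OF A(1) C_bounded \<alpha>\<beta>(2) C_coercive])
  define R where "R n = inverse_op (plus_op (C n) A)" for n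
  define K where "K n f = C n (R n f)" for n f
  have R: "bounded_clinear (R n)" for n unfolding R_def by (rule inverse_op(1)[OF inv])
  have K: "bounded_clinear (K n)" for n
    using R[of n] C_bounded[of n] bounded_linear_compose[of "C n" "R n"]
    by (simp add: K_def[abs_def] bounded_clinear_def)
  have RA: "(R n f, f - K n f) \<in> A" for n f
    using inverse_plus_op_iff[OF inv, of n f "R n f"] by (simp add: R_def K_def)
  have R_bound: "norm (R n f) \<le> 1 / \<alpha> * norm f" for n f
    using coercive_norm_bound[where T = "C n", OF A(1) C_coercive RA[of n f, unfolded K_def]] \<alpha>\<beta>(2)
    by (simp add: field_simps)
  have K_bound: "norm (K n f) \<le> \<beta> / \<alpha> * norm f" for n f
    using cocoercive_norm_bound[OF \<beta> C_cocoercive, of n "R n f"]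
      mult_left_mono[OF R_bound[of n f], of \<beta>] \<beta> unfolding K_def by simp
  \<comment> \<open>The subsequence is extracted first for the resolvents and then, within it, for \<open>K\<close>.\<close>
  obtain r1 R' where r1: "strict_mono (r1 :: nat \<Rightarrow> nat)" and R': "bounded_clinear R'"
    and lim1: "\<And>x y. (\<lambda>n. cinner (R (r1 n) x) y) \<longlonglongrightarrow> cinner (R' x) y"
    using uniformly_bounded_weakly_convergent_subsequence[of R, OF separable R R_bound]
    by (elim exE conjE, intro that) auto
  obtain r2 K' where r2: "strict_mono (r2 :: nat \<Rightarrow> nat)" and K': "bounded_clinear K'"
    and limK: "\<And>x y. (\<lambda>n. cinner (K (r1 (r2 n)) x) y) \<longlonglongrightarrow> cinner (K' x) y"
    using uniformly_bounded_weakly_convergent_subsequence[of "\<lambda>n. K (r1 n)", OF separable K K_bound]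
    by (elim exE conjE, intro that) auto
  define r where "r = r1 \<circ> r2"
  have r: "strict_mono r" unfolding r_def using r1 r2 by (rule strict_mono_o)
  have limR: "(\<lambda>n. cinner (R (r n) x) y) \<longlonglongrightarrow> cinner (R' x) y" for x y
    using LIMSEQ_subseq_LIMSEQ[OF lim1[of x y] r2] by (simp add: r_def o_def)
  have limK: "(\<lambda>n. cinner (K (r n) x) y) \<longlonglongrightarrow> cinner (K' x) y" for x y
    using limK[of x y] by (simp add: r_def)
  have RA': "(R' f, f - K' f) \<in> A" for f
  proof (rule m_accretive_weakly_closed[OF A(1) RA])
    show "(\<lambda>n. cinner (f - K (r n) f) y) \<longlonglongrightarrow> cinner (f - K' f) y" for y
      unfolding cinner_diff_left by (intro tendsto_intros limK)
  qed (rule limR)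
  have coercive: "\<alpha> * (norm (R' f))\<^sup>2 \<le> Re (cinner (K' f) (R' f))" for f
    by (rule coercivity_of_weak_limit[OF A(1) RA limR RA' limK limR])
      (use \<alpha>\<beta> C_coercive in \<open>auto simp: K_def\<close>)
  have cocoercive: "1 / \<beta> * (norm (K' f))\<^sup>2 \<le> Re (cinner (K' f) (R' f))" for f
    by (rule coercivity_of_weak_limit[OF A(1) RA limR RA' limK limK])
      (use \<beta> C_cocoercive in \<open>auto simp: K_def\<close>)
  have K'_bound: "norm (K' f) \<le> \<beta> * norm (R' f)" for f
    by (rule cocoercive_norm_bound[OF \<beta> cocoercive])
  \<comment> \<open>From here on, \<open>K' = D R'\<close> has to be solved for \<open>D\<close>, which requires a dense range of \<open>R'\<close>.\<close>
  have "f = 0" if f: "cinner (R' f) f = 0" for f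
  proof -
    have "Re (cinner (f - K' f) (R' f)) \<ge> 0" by (rule m_accretive_Re[OF A(1) RA'])
    then have "\<alpha> * (norm (R' f))\<^sup>2 \<le> 0"
      using coercive[of f] f Re_cinner_commute[of f "R' f"] by (simp add: cinner_simps)
    then have R0: "R' f = 0" using \<alpha>\<beta>(2) by (simp add: mult_le_0_iff)
    then have K0: "K' f = 0" using K'_bound[of f] by simp
    have "(0, 0) \<in> A" "single_valued A"
      using m_accretive_linear[OF A(1)] by (auto simp: linear_operator_def)
    then show "f = 0" using RA'[of f] R0 K0 by (auto dest: single_valuedD)
  qed
  then have dense: "closure (range R') = UNIV" using closure_range_eq_UNIV[OF R'] by blast
  obtain D where D: "bounded_clinear D" and DR: "\<And>f. D (R' f) = K' f"
    using bounded_clinear_factor_through_dense_range[OF R' K' dense K'_bound] by blast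
  interpret D: bounded_linear D using D by (rule bounded_clinear_bounded_linear)
  have D_ineq: "max (\<alpha> * (norm \<phi>)\<^sup>2) (1 / \<beta> * (norm (D \<phi>))\<^sup>2) \<le> Re (cinner (D \<phi>) \<phi>)" for \<phi>
  proof -
    have "\<phi> \<in> closure (range R')" using dense by simp
    then obtain a where Ra: "(\<lambda>n. R' (a n)) \<longlonglongrightarrow> \<phi>"
      unfolding closure_range_sequential by (rule exE)
    have Da: "(\<lambda>n. K' (a n)) \<longlonglongrightarrow> D \<phi>" using D.tendsto[OF Ra] by (simp add: DR)
    note lim = tendsto_Re[OF tendsto_cinner[OF Da Ra]]
    have "\<alpha> * (norm \<phi>)\<^sup>2 \<le> Re (cinner (D \<phi>) \<phi>)"
      by (rule LIMSEQ_le[OF tendsto_mult_left[OF tendsto_power[OF tendsto_norm[OF Ra]]] lim])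
        (use coercive in blast)
    moreover have "1 / \<beta> * (norm (D \<phi>))\<^sup>2 \<le> Re (cinner (D \<phi>) \<phi>)"
      by (rule LIMSEQ_le[OF tendsto_mult_left[OF tendsto_power[OF tendsto_norm[OF Da]]] lim])
        (use cocoercive in blast)
    ultimately show ?thesis by simp
  qed
  have D_inv: "boundedly_invertible (plus_op D A)"
    by (rule coercive_perturbation_boundedly_invertible[OF A(1) D \<alpha>\<beta>(2)])
      (use D_ineq in auto)
  have "inverse_op (plus_op D A) = R'"
    using RA' by (simp add: fun_eq_iff inverse_plus_op_iff[OF D_inv] DR)
  then have "limitin weak_operator_topology (\<lambda>k. inverse_op (plus_op (C (r k)) A))
      (inverse_op (plus_op D A)) sequentially"
    using R R' limR by (simp add: limitin_weak_operator_topology R_def[symmetric])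
  with inv r D D_ineq D_inv show ?thesis by blast
qed

end
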